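(* For any integer partitions $\lambda$ and $\mu$, $$\tilde\Xi_{\lambda,\mu}(1^i;1)=\binom{i+d-\ell(\lambda)}{d},$$ where $d=|\lambda|+|\mu|$.
   Context: For an integer partition $\lambda$, $\ell(\lambda)$ is the number of parts and $|\lambda|$ the sum of the parts. For integer partitions $\lambda,\mu$, $D_{\lambda,\mu}$ is the digraph which is a disjoint union of directed paths and directed cycles such that the $i$th directed path has $\lambda_i$ vertices and the $j$th directed cycle has $\mu_j$ vertices (a cycle of length one is a loop; a cycle of length two is a pair of opposite edges). A path-cycle cover of a digraph is a subset $S$ of its edges such that the spanning subgraph with edge set $S$ is a vertex-disjoint union of directed paths and directed cycles (isolated vertices are directed paths with no edges). $\pi(S)$ and $\sigma(S)$ are the sets of vertex sets of the paths and cycles respectively, $\ell(\pi(S))$ is the number of paths, and a set partition in a subscript stands for the integer partition of its block sizes. With $\tilde m_\lambda=(r_1!r_2!\cdots)m_\lambda$ ($r_i$ the number of parts of $\lambda$ equal to $i$), $p_\lambda$ the power sums, and $x,y$ two countably infinite sets of commuting indeterminates, $$\tilde\Xi_{\lambda,\mu}=\tilde\Xi_{\lambda,\mu}(x;y)=\sum_S\frac{\tilde m_{\pi(S)}(x)\,p_{\sigma(S)}(y)}{\ell(\pi(S))!},$$ the sum over all path-cycle covers $S$ of $D_{\lambda,\mu}$. The notation $g(1^i;1)$ means the polynomial in $i$ obtained by setting $i$ of the $x$ variables equal to $1$ and the rest equal to $0$, and setting one of the $y$ variables equal to $1$ and the rest equal to $0$. *)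

theory Defs
  imports
    "Graph_Theory.Digraph_Component"
    "HOL-Library.Multiset"
    "HOL-Library.Disjoint_Sets"
    "HOL-Library.Groups_Big_Fun"
    "HOL-Computational_Algebra.Polynomial"
begin

definition integer_partition :: "nat list \<Rightarrow> bool" where
  "integer_partition lam \<longleftrightarrow> sorted_wrt (\<ge>) lam \<and> (\<forall>k\<in>set lam. 0 < k)"

definition block_sizes :: "'a set set \<Rightarrow> nat list" where
  "block_sizes P = rev (sorted_list_of_multiset (image_mset card (mset_set P)))"


section \<open>Path-cycle covers\<close>

text \<open>
  The whole digraph \<open>H\<close> is one directed path, respectively one directed cycle.
  The path may have no arcs; the library's notion of cycle includes loops and
  pairs of opposite arcs.
\<close>

definition is_dipath :: "('a, 'b) pre_digraph \<Rightarrow> bool" where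
  "is_dipath H \<longleftrightarrow> (\<exists>u p v. pre_digraph.apath H u p v \<and>
     set (pre_digraph.awalk_verts H u p) = verts H \<and> set p = arcs H)"

definition is_dicycle :: "('a, 'b) pre_digraph \<Rightarrow> bool" where
  "is_dicycle H \<longleftrightarrow> (\<exists>p. pre_digraph.cycle H p \<and> tail H ` set p = verts H \<and> set p = arcs H)"

text \<open>Vertex sets that no arc of \<open>H\<close> enters or leaves.\<close>

definition arc_closed :: "('a, 'b) pre_digraph \<Rightarrow> 'a set \<Rightarrow> bool" where
  "arc_closed H B \<longleftrightarrow> B \<subseteq> verts H \<and> (\<forall>e\<in>arcs H. tail H e \<in> B \<longleftrightarrow> head H e \<in> B)"

definition path_blocks :: "('a, 'b) pre_digraph \<Rightarrow> 'a set set" where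
  "path_blocks H = {B. arc_closed H B \<and> is_dipath (H \<restriction> B)}"

definition cycle_blocks :: "('a, 'b) pre_digraph \<Rightarrow> 'a set set" where
  "cycle_blocks H = {B. arc_closed H B \<and> is_dicycle (H \<restriction> B)}"

abbreviation spanning_sub :: "('a, 'b) pre_digraph \<Rightarrow> 'b set \<Rightarrow> ('a, 'b) pre_digraph" where
  "spanning_sub D S \<equiv> D\<lparr>arcs := S\<rparr>"

definition path_cycle_covers :: "('a, 'b) pre_digraph \<Rightarrow> 'b set set" where
  "path_cycle_covers D = {S. S \<subseteq> arcs D \<and>
     partition_on (verts D) (path_blocks (spanning_sub D S) \<union> cycle_blocks (spanning_sub D S))}"

abbreviation cover_paths :: "('a, 'b) pre_digraph \<Rightarrow> 'b set \<Rightarrow> 'a set set" where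
  "cover_paths D S \<equiv> path_blocks (spanning_sub D S)"

abbreviation cover_cycles :: "('a, 'b) pre_digraph \<Rightarrow> 'b set \<Rightarrow> 'a set set" where
  "cover_cycles D S \<equiv> cycle_blocks (spanning_sub D S)"

text \<open>
  \<open>Inl (i, k)\<close> is the \<open>k\<close>-th vertex of the \<open>i\<close>-th path and \<open>Inr (j, k)\<close> the \<open>k\<close>-th
  vertex of the \<open>j\<close>-th cycle, all indices counted from 0.
\<close>

type_synonym pc_vertex = "nat \<times> nat + nat \<times> nat"

definition path_cycle_digraph ::
    "nat list \<Rightarrow> nat list \<Rightarrow> (pc_vertex, pc_vertex \<times> pc_vertex) pre_digraph" where
  "path_cycle_digraph lam mu = with_proj \<lparr>
     pverts = {Inl (i, k) | i k. i < length lam \<and> k < lam ! i} \<union>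
              {Inr (j, k) | j k. j < length mu \<and> k < mu ! j},
     parcs = {(Inl (i, k), Inl (i, Suc k)) | i k. i < length lam \<and> Suc k < lam ! i} \<union>
             {(Inr (j, k), Inr (j, Suc k mod mu ! j)) | j k. j < length mu \<and> k < mu ! j}\<rparr>"


section \<open>Power series in countably many indeterminates\<close>

text \<open>
  A monomial is the multiset of its indeterminates (the exponent of \<open>x\<^sub>k\<close> in \<open>M\<close> is
  \<open>count M k\<close>), and a formal power series is its family of coefficients.
  A series in \<open>x\<close> and \<open>y\<close> takes the \<open>x\<close>-part and the \<open>y\<close>-part of the monomial.
\<close>

type_synonym series = "nat multiset \<Rightarrow> rat"
type_synonym series2 = "nat multiset \<Rightarrow> nat multiset \<Rightarrow> rat"

definition series_one :: series where
  "series_one M = of_bool (M = {#})"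

definition series_times :: "series \<Rightarrow> series \<Rightarrow> series" where
  "series_times f g M = (\<Sum>A | A \<subseteq># M. f A * g (M - A))"

definition monomial_sym :: "nat list \<Rightarrow> series" where
  "monomial_sym lam M = of_bool (image_mset (count M) (mset_set (set_mset M)) = mset lam)"

definition aug_monomial_sym :: "nat list \<Rightarrow> series" where
  "aug_monomial_sym lam M =
     (\<Prod>r\<in>set lam. fact (count_list lam r)) * monomial_sym lam M"

text \<open>Used for \<open>r > 0\<close> only: \<open>\<Sum>k. x\<^sub>k ^ r\<close>.\<close>

definition power_sum1 :: "nat \<Rightarrow> series" where
  "power_sum1 r M = of_bool (\<exists>k. M = replicate_mset r k)"

definition power_sum :: "nat list \<Rightarrow> series" where
  "power_sum mu = foldr (\<lambda>r f. series_times (power_sum1 r) f) mu series_one"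

definition Xi_tilde :: "nat list \<Rightarrow> nat list \<Rightarrow> series2" where
  "Xi_tilde lam mu A B =
     (let D = path_cycle_digraph lam mu in
      \<Sum>S\<in>path_cycle_covers D.
        aug_monomial_sym (block_sizes (cover_paths D S)) A *
        power_sum (block_sizes (cover_cycles D S)) B /
        fact (card (cover_paths D S)))"


section \<open>Specialization\<close>

text \<open>
  Substitution of values for the indeterminates. \<open>Sum_any\<close> adds up the nonzero terms;
  there are finitely many of these when \<open>g\<close> has bounded degree and \<open>x\<close>, \<open>y\<close> have finite
  support, which is the only intended use.
\<close>

definition subst2 :: "series2 \<Rightarrow> (nat \<Rightarrow> rat) \<Rightarrow> (nat \<Rightarrow> rat) \<Rightarrow> rat" where
  "subst2 g x y = Sum_any (\<lambda>(A, B). g A B * (\<Prod>k\<in>#A. x k) * (\<Prod>k\<in>#B. y k))"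

text \<open>
  \<open>P\<close> is the polynomial \<open>g(1\<^sup>i; 1)\<close> in \<open>i\<close>: its value at every natural number \<open>i\<close>, which
  determines it, is obtained by setting any \<open>i\<close> of the \<open>x\<close> indeterminates and any one of
  the \<open>y\<close> indeterminates to 1 and the remaining ones to 0.
\<close>

definition is_ones_poly :: "series2 \<Rightarrow> rat poly \<Rightarrow> bool" where
  "is_ones_poly g P \<longleftrightarrow> (\<forall>I j. finite I \<longrightarrow>
     subst2 g (\<lambda>k. of_bool (k \<in> I)) (\<lambda>k. of_bool (k = j)) = poly P (of_nat (card I)))"

end

theory Submission
  imports Defs
begin

text \<open>
  Write \<open>D\<close> for the digraph, \<open>E\<close> for its arc set and \<open>d\<close> for its number of vertices.

  The specialization first. With \<open>i\<close> indeterminates equal to 1, the augmented monomial function of a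
  partition with \<open>l\<close> parts takes the value \<open>i (i - 1) \<dots> (i - l + 1)\<close>, because it counts the injective
  assignments of indeterminates to the parts (\<open>symmetry_card_monomials_of_type\<close>). Division by \<open>l!\<close>
  turns it into \<open>i choose l\<close>. A power sum in one indeterminate equal to 1 has the value 1. So a cover
  with \<open>l\<close> paths contributes \<open>i choose l\<close>, whatever the sizes of its blocks
  (\<open>subst2_sum_aug_monomial_power_sum\<close>).

  The covers next. In \<open>D\<close> every in-degree and every out-degree is at most one, and this remains
  true for every \<open>S \<subseteq> E\<close>. A finite digraph with this property is a disjoint union of paths and cycles
  (\<open>partition_on_blocks\<close>), so every subset of \<open>E\<close> is a cover. A path has one vertex more than arcs and a
  cycle has equally many, hence \<open>S\<close> has \<open>d - card S\<close> paths (\<open>card_path_blocks\<close>). For the same reason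
  \<open>card E = d - length lam\<close>.

  The specialization is therefore the sum of \<open>(card E choose k) * (i choose (d - k))\<close> over \<open>k\<close>, which
  by Vandermonde's identity is \<open>(i + d - length lam) choose d\<close>.
\<close>

section \<open>Digraphs with in- and out-degrees at most one\<close>

text \<open>
  All in- and out-degrees are at most one. Spanning subgraphs inherit this property, so it is
  available for every set of arcs that could be a cover.
\<close>

locale linear_digraph = fin_digraph +
  assumes inj_tail: "inj_on (tail G) (arcs G)"
    and inj_head: "inj_on (head G) (arcs G)"
begin

text \<open>
  The definition of a block speaks of walks in the induced subgraph. Since no arc crosses the
  boundary of a block, its arcs are all the arcs of \<open>G\<close> that meet it, and the walk can be taken
  in \<open>G\<close> itself. This form is the one that the later arguments use, likewise for cycles.
\<close>

lemma path_blocks_iff: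
  "B \<in> path_blocks G \<longleftrightarrow> (\<exists>u p v. apath u p v \<and> set (awalk_verts u p) = B \<and>
     set p = {e \<in> arcs G. tail G e \<in> B \<or> head G e \<in> B})" (is "?L \<longleftrightarrow> ?R")
proof
  assume ?L
  then obtain u p v where "arc_closed G B" "pre_digraph.apath (G \<restriction> B) u p v"
    "set (awalk_verts u p) = B" "set p = arcs (G \<restriction> B)"
    by (auto simp: path_blocks_def is_dipath_def
        compatible_awalk_verts[OF compatible_induce_subgraph])
  then show ?R
    by (intro exI[of _ u] exI[of _ p] exI[of _ v])
      (auto simp: arc_closed_def pre_digraph.apath_def pre_digraph.awalk_def
        compatible_awalk_verts[OF compatible_induce_subgraph]
        compatible_cas[OF compatible_induce_subgraph])
next
  assume ?R
  then obtain u p v where p: "apath u p v" "set (awalk_verts u p) = B"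
     "set p = {e \<in> arcs G. tail G e \<in> B \<or> head G e \<in> B}" by blast
  have aw: "awalk u p v" using p(1) by (rule awalkI_apath)
  have closed: "arc_closed G B"
    unfolding arc_closed_def
  proof (intro conjI ballI)
    show "B \<subseteq> verts G" using aw p(2) by blast
    show "tail G e \<in> B \<longleftrightarrow> head G e \<in> B" if "e \<in> arcs G" for e
      using that p(2,3) awalk_verts_arc1[of e p u] awalk_verts_arc2[OF aw, of e] by blast
  qed
  have "u \<in> B" using hd_in_awalk_verts(1)[OF aw] p(2) by simp
  then have "is_dipath (G \<restriction> B)"
    unfolding is_dipath_def using p closed aw
    by (intro exI[of _ u] exI[of _ p] exI[of _ v])
      (auto simp: arc_closed_def pre_digraph.apath_def pre_digraph.awalk_def
        compatible_awalk_verts[OF compatible_induce_subgraph]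
        compatible_cas[OF compatible_induce_subgraph])
  with closed show ?L by (simp add: path_blocks_def)
qed

lemma awalk_verts_eq_heads: "cas u p v \<Longrightarrow> awalk_verts u p = u # map (head G) p"
  by (induction p arbitrary: u) auto

lemma closed_walk_verts:
  assumes "awalk u p u" "p \<noteq> []"
  shows "set (awalk_verts u p) = tail G ` set p" "set (awalk_verts u p) = head G ` set p"
proof -
  have t: "u \<in> tail G ` set p"
    using assms by (cases p) (auto simp: awalk_Cons_iff)
  have l: "head G (last p) = u"
    using awlast_of_awalk[OF assms(1)] assms by (simp add: awalk_verts_conv)
  then show "set (awalk_verts u p) = tail G ` set p"
    using assms(2) t by (auto simp: awalk_verts_conv)
  have "cas u p u" using assms(1) by blast
  moreover have "tail G (hd p) = u" using assms by (cases p) (auto simp: awalk_Cons_iff)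
  moreover have "u \<in> head G ` set p" using l assms(2) by force
  ultimately show "set (awalk_verts u p) = head G ` set p"
    using assms(2) by (auto simp: awalk_verts_conv')
qed

lemma cycle_blocks_iff:
  "B \<in> cycle_blocks G \<longleftrightarrow> (\<exists>p. cycle p \<and> tail G ` set p = B \<and>
     set p = {e \<in> arcs G. tail G e \<in> B \<or> head G e \<in> B})" (is "?L \<longleftrightarrow> ?R")
proof
  assume ?L
  then obtain u p where "arc_closed G B" "pre_digraph.awalk (G \<restriction> B) u p u"
    "distinct (tl (awalk_verts u p))" "p \<noteq> []"
    "tail G ` set p = B" "set p = arcs (G \<restriction> B)"
    by (auto simp: cycle_blocks_def is_dicycle_def pre_digraph.cycle_def
        compatible_awalk_verts[OF compatible_induce_subgraph])
  then show ?R
    by (intro exI[of _ p])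
      (auto simp: arc_closed_def cycle_def pre_digraph.awalk_def
        compatible_cas[OF compatible_induce_subgraph])
next
  assume ?R
  then obtain u p where p: "awalk u p u" "distinct (tl (awalk_verts u p))" "p \<noteq> []"
     "tail G ` set p = B" "set p = {e \<in> arcs G. tail G e \<in> B \<or> head G e \<in> B}"
    by (auto simp: cycle_def)
  have "u \<in> B"
    using p(1,3,4) by (cases p) (auto simp: awalk_Cons_iff)
  have hd: "head G ` set p = B"
    using closed_walk_verts[OF p(1,3)] p(4) by simp
  have "B \<subseteq> verts G"
    using closed_walk_verts(1)[OF p(1,3)] p(1,4) by auto
  then have closed: "arc_closed G B"
    unfolding arc_closed_def
  proof (intro conjI ballI)
    show "tail G e \<in> B \<longleftrightarrow> head G e \<in> B" if "e \<in> arcs G" for e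
    proof -
      have "e \<in> set p" if "tail G e \<in> B \<or> head G e \<in> B"
        using that \<open>e \<in> arcs G\<close> p(5) by simp
      then show ?thesis using hd p(4) by blast
    qed
  qed
  have "is_dicycle (G \<restriction> B)"
    unfolding is_dicycle_def pre_digraph.cycle_def using p hd \<open>u \<in> B\<close>
    by (intro exI[of _ p] conjI exI[of _ u])
      (auto simp: pre_digraph.awalk_def
        compatible_awalk_verts[OF compatible_induce_subgraph]
        compatible_cas[OF compatible_induce_subgraph])
  with closed show ?L by (simp add: cycle_blocks_def)
qed

text \<open>
  A walk cannot cross the boundary of an arc-closed set. As every block is traced out by one walk,
  this makes two blocks that meet equal.
\<close>

lemma arc_closed_awalk:
  assumes "arc_closed G C" "awalk u p v"
  shows "set (awalk_verts u p) \<subseteq> C \<or> set (awalk_verts u p) \<inter> C = {}"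
  using assms(2)
proof (induction p arbitrary: u)
  case (Cons e p)
  then have "tail G e \<in> C \<longleftrightarrow> head G e \<in> C"
    using assms(1) by (auto simp: arc_closed_def awalk_Cons_iff)
  moreover have "head G e \<in> set (awalk_verts (head G e) p)"
    using Cons.prems by (auto simp: awalk_Cons_iff intro: hd_in_awalk_verts)
  ultimately show ?case
    using Cons.IH[of "head G e"] Cons.prems by (auto simp: awalk_Cons_iff)
qed auto

lemma block_walk:
  assumes "B \<in> path_blocks G \<union> cycle_blocks G"
  obtains u p v where "awalk u p v" "set (awalk_verts u p) = B"
  using assms
proof
  assume "B \<in> path_blocks G"
  then show ?thesis using that by (auto simp: path_blocks_iff apath_def)
next
  assume "B \<in> cycle_blocks G"
  then obtain u p where "awalk u p u" "p \<noteq> []" "tail G ` set p = B"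
    by (auto simp: cycle_blocks_iff cycle_def)
  then show ?thesis using that closed_walk_verts(1) by blast
qed

lemma block_eqI:
  assumes "B \<in> path_blocks G \<union> cycle_blocks G" "C \<in> path_blocks G \<union> cycle_blocks G"
    and "B \<inter> C \<noteq> {}"
  shows "B = C"
proof -
  have "B \<subseteq> C" if B: "B \<in> path_blocks G \<union> cycle_blocks G"
    and C: "C \<in> path_blocks G \<union> cycle_blocks G" and "B \<inter> C \<noteq> {}" for B C
  proof -
    from B obtain u p v where "awalk u p v" "set (awalk_verts u p) = B" by (rule block_walk)
    moreover have "arc_closed G C"
      using C unfolding path_blocks_def cycle_blocks_def by blast
    ultimately show ?thesis
      using arc_closed_awalk[of C u p v] that(3) by simp
  qed
  from this[OF assms] this[OF assms(2,1)] assms(3) show ?thesis by (simp add: Int_commute)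
qed

lemma apath_no_arc_into_start:
  assumes "apath u p v" "e \<in> set p" shows "head G e \<noteq> u"
proof -
  have "cas u p v" using assms(1) by (auto simp: apath_def)
  then have "awalk_verts u p = u # map (head G) p" by (rule awalk_verts_eq_heads)
  then show ?thesis using assms by (auto simp: apath_def)
qed

lemma apath_no_arc_from_end:
  assumes "apath u p v" "e \<in> set p" shows "tail G e \<noteq> v"
proof -
  have "last (awalk_verts u p) = v" using assms(1) by (auto simp: apath_def)
  then have "awalk_verts u p = map (tail G) p @ [v]"
    using assms(2) by (auto simp: awalk_verts_conv)
  then show ?thesis using assms by (auto simp: apath_def)
qed

text \<open>
  With out-degree at most one, the arc that leaves an inner vertex of a path is the next arc of the
  path; dually, the arc that enters any vertex but the first one belongs to the path. So only arcs
  leaving the last vertex or entering the first one can connect a path to anything else.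
\<close>

lemma apath_tailE:
  assumes "apath u p v" "e \<in> arcs G" "tail G e \<in> set (awalk_verts u p)" "tail G e \<noteq> v"
  shows "e \<in> set p"
proof -
  have aw: "awalk u p v" using assms(1) by (rule awalkI_apath)
  then have "last (awalk_verts u p) = v" by auto
  with assms(3,4) have "tail G e \<in> tail G ` set p" by (auto simp: awalk_verts_conv split: if_splits)
  then show ?thesis using aw assms(2) inj_tail by (auto dest: inj_onD)
qed

lemma apath_headE:
  assumes "apath u p v" "e \<in> arcs G" "head G e \<in> set (awalk_verts u p)" "head G e \<noteq> u"
  shows "e \<in> set p"
proof -
  have aw: "awalk u p v" using assms(1) by (rule awalkI_apath)
  then have "hd (awalk_verts u p) = u" "cas u p v" by auto
  with assms(3,4) have "head G e \<in> head G ` set p"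
    by (auto simp: awalk_verts_conv' split: if_splits)
  then show ?thesis using aw assms(2) inj_head by (auto dest: inj_onD)
qed

text \<open>
  Take a longest path through \<open>x\<close>. By maximality an arc that leaves its end comes back to the path,
  and it can come back only to its start, because the other vertices already have an entering arc.
  Then the path closes up to a cycle. Otherwise no arc leaves the end, and an arc that enters the
  start would have to come from a vertex of the path whose only leaving arc is part of the path. So
  the path is a component by itself.
\<close>

lemma vertex_in_block:
  assumes "x \<in> verts G"
  shows "\<exists>B \<in> path_blocks G \<union> cycle_blocks G. x \<in> B"
proof -
  define Q where "Q p \<longleftrightarrow> (\<exists>u v. apath u p v \<and> x \<in> set (awalk_verts u p))" for p
  have "Q []" unfolding Q_def
    by (intro exI[of _ x]) (use assms in \<open>auto simp: apath_Nil_iff\<close>)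
  moreover have "\<forall>p. Q p \<longrightarrow> length p < card (verts G)"
    unfolding Q_def using length_apath_less by blast
  ultimately obtain p where "Q p" and max: "\<And>q. Q q \<Longrightarrow> length q \<le> length p"
    using ex_has_greatest_nat[of Q "[]" length "card (verts G)"] by auto
  then obtain u v where p: "apath u p v" and x: "x \<in> set (awalk_verts u p)"
    by (auto simp: Q_def)
  let ?B = "set (awalk_verts u p)"
  have aw: "awalk u p v" using p by (rule awalkI_apath)
  have last: "awlast u p = v" using aw by auto
  \<comment> \<open>an arc from the end to anywhere else would prolong the path\<close>
  have no_exit: "head G e = u" if e: "e \<in> arcs G" "tail G e = v" for e
  proof (rule ccontr)
    assume ne: "head G e \<noteq> u"
    have "head G e \<notin> ?B"
      using apath_headE[OF p e(1) _ ne] apath_no_arc_from_end[OF p, of e] e(2) by auto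
    moreover have "v \<in> ?B" using last by (metis awalk_verts_non_Nil last_in_set)
    ultimately have "head G e \<noteq> v" by blast
    with \<open>head G e \<notin> ?B\<close> have "apath u (p @ [e]) (head G e)"
      using p e last by (auto simp: apath_append_iff apath_simps)
    moreover have "x \<in> set (awalk_verts u (p @ [e]))"
      using x e(2) last by (auto simp: awalk_verts_conv split: if_splits)
    ultimately have "Q (p @ [e])" unfolding Q_def by blast
    then show False using max[of "p @ [e]"] by simp
  qed
  show ?thesis
  proof (cases "\<exists>e \<in> arcs G. tail G e = v")
    case True
    then obtain e where e: "e \<in> arcs G" "tail G e = v" "head G e = u" using no_exit by blast
    let ?p = "p @ [e]"
    have aw': "awalk u ?p u" using aw e last by (auto simp: awalk_simps)
    have B: "set (awalk_verts u ?p) = ?B"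
      using closed_walk_verts(1)[OF aw'] e last aw
      by (auto simp: awalk_verts_conv split: if_splits)
    have "distinct (tl (awalk_verts u ?p))"
    proof -
      have "cas u ?p u" "cas u p v" using aw aw' by auto
      then have "awalk_verts u ?p = u # map (head G) ?p"
        "awalk_verts u p = u # map (head G) p"
        by (blast intro: awalk_verts_eq_heads)+
      moreover have "distinct (awalk_verts u p)" using p by (simp add: apath_def)
      ultimately show ?thesis using e(3) by simp
    qed
    then have "cycle ?p" unfolding cycle_def using aw' by blast
    moreover have "tail G ` set ?p = ?B" using closed_walk_verts(1)[OF aw'] B by simp
    moreover have "set ?p = {e \<in> arcs G. tail G e \<in> ?B \<or> head G e \<in> ?B}"
    proof (intro equalityI subsetI)
      fix f assume "f \<in> set ?p"
      then show "f \<in> {e \<in> arcs G. tail G e \<in> ?B \<or> head G e \<in> ?B}"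
        using aw' B awalk_verts_arc1[of f ?p u] by auto
    next
      fix f assume "f \<in> {e \<in> arcs G. tail G e \<in> ?B \<or> head G e \<in> ?B}"
      then show "f \<in> set ?p"
        using apath_tailE[OF p, of f] apath_headE[OF p, of f] e inj_tail inj_head
        by (auto dest: inj_onD)
    qed
    ultimately have "?B \<in> cycle_blocks G" unfolding cycle_blocks_iff by blast
    then show ?thesis using x by blast
  next
    case False
    \<comment> \<open>otherwise \<open>e\<close> would prolong the path at its start\<close>
    have no_entry: "head G e \<noteq> u" if e: "e \<in> arcs G" for e
    proof
      assume h: "head G e = u"
      have "tail G e \<noteq> v" using e False by blast
      then have "tail G e \<notin> ?B"
        using apath_tailE[OF p e] apath_no_arc_into_start[OF p, of e] h by blast
      then have "apath (tail G e) (e # p) v" using p e h by (simp add: apath_simps)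
      moreover have "x \<in> set (awalk_verts (tail G e) (e # p))" using x h by simp
      ultimately have "Q (e # p)" unfolding Q_def by blast
      then show False using max[of "e # p"] by simp
    qed
    have "set p = {e \<in> arcs G. tail G e \<in> ?B \<or> head G e \<in> ?B}"
    proof (intro equalityI subsetI)
      fix f assume "f \<in> set p"
      then show "f \<in> {e \<in> arcs G. tail G e \<in> ?B \<or> head G e \<in> ?B}"
        using aw awalk_verts_arc1[of f p u] by auto
    next
      fix f assume "f \<in> {e \<in> arcs G. tail G e \<in> ?B \<or> head G e \<in> ?B}"
      then show "f \<in> set p"
        using apath_tailE[OF p, of f] apath_headE[OF p, of f] False no_entry by blast
    qed
    then have "?B \<in> path_blocks G" unfolding path_blocks_iff using p by blast
    then show ?thesis using x by blast
  qed
qed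

lemma partition_on_blocks: "partition_on (verts G) (path_blocks G \<union> cycle_blocks G)"
  unfolding partition_on_def
proof (intro conjI)
  have "B \<subseteq> verts G" if "B \<in> path_blocks G \<union> cycle_blocks G" for B
    using that by (auto simp: path_blocks_def cycle_blocks_def arc_closed_def)
  then show "\<Union> (path_blocks G \<union> cycle_blocks G) = verts G"
    using vertex_in_block by blast
  show "disjoint (path_blocks G \<union> cycle_blocks G)"
    unfolding disjoint_def using block_eqI by blast
  show "{} \<notin> path_blocks G \<union> cycle_blocks G"
    by (metis awalk_verts_non_Nil block_walk set_empty)
qed

text \<open>
  The paths are counted by their starting points: a path block contains exactly one vertex without
  an entering arc and a cycle block contains none. As heads are distinct, the number of vertices
  without an entering arc is the number of vertices minus the number of arcs.
\<close>

lemma card_path_blocks: "card (path_blocks G) = card (verts G) - card (arcs G)"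
proof -
  let ?S = "verts G - head G ` arcs G"
  have path: "card (B \<inter> ?S) = 1" if B: "B \<in> path_blocks G" for B
  proof -
    obtain u p v where p: "apath u p v" "set (awalk_verts u p) = B"
      "set p = {e \<in> arcs G. tail G e \<in> B \<or> head G e \<in> B}"
      using B by (auto simp: path_blocks_iff)
    have aw: "awalk u p v" using p(1) by (rule awalkI_apath)
    then have "cas u p v" by auto
    then have "B = insert u (head G ` set p)"
      using p(2) awalk_verts_eq_heads[of u p v] by auto
    moreover have "B \<subseteq> verts G" using aw p(2) by auto
    moreover have "u \<notin> head G ` arcs G"
    proof
      assume "u \<in> head G ` arcs G"
      then obtain e where e: "e \<in> arcs G" "head G e = u" by blast
      have "u \<in> B" using hd_in_awalk_verts(1)[OF aw] p(2) by simp
      with e have "e \<in> set p" unfolding p(3) by blast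
      then show False using apath_no_arc_into_start[OF p(1)] e(2) by blast
    qed
    moreover have "head G ` set p \<subseteq> head G ` arcs G" using p(3) by auto
    ultimately have "B \<inter> ?S = {u}" by auto
    then show ?thesis by simp
  qed
  have cyc: "B \<inter> ?S = {}" if B: "B \<in> cycle_blocks G" for B
  proof -
    obtain u p where p: "awalk u p u" "p \<noteq> []" "tail G ` set p = B"
      using B by (auto simp: cycle_blocks_iff cycle_def)
    have "B = head G ` set p" using closed_walk_verts[OF p(1,2)] p(3) by simp
    moreover have "set p \<subseteq> arcs G" using p(1) by auto
    ultimately show ?thesis by auto
  qed
  note part = partition_on_blocks
  have fin: "finite (path_blocks G)"
    using finite_elements[OF finite_verts part] by simp
  have "?S = (\<Union>B\<in>path_blocks G. B \<inter> ?S)"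
    using partition_onD1[OF part] cyc by blast
  then have "card ?S = card (\<Union>B\<in>path_blocks G. B \<inter> ?S)" by simp
  also have "\<dots> = (\<Sum>B\<in>path_blocks G. card (B \<inter> ?S))"
    by (rule card_UN_disjoint) (use fin block_eqI in auto)
  also have "\<dots> = card (path_blocks G)" by (simp add: path)
  finally show ?thesis
    using card_Diff_subset[of "head G ` arcs G" "verts G"] card_image[OF inj_head]
    by (simp add: image_subset_iff)
qed

end

lemma linear_digraph_subset_arcs:
  assumes "linear_digraph D" "S \<subseteq> arcs D"
  shows "linear_digraph (D\<lparr>arcs := S\<rparr>)"
proof -
  interpret linear_digraph D by fact
  show ?thesis
  proof
    show "finite (arcs (D\<lparr>arcs := S\<rparr>))" using finite_subset[OF assms(2) finite_arcs] by simp
    show "inj_on (tail (D\<lparr>arcs := S\<rparr>)) (arcs (D\<lparr>arcs := S\<rparr>))"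
      "inj_on (head (D\<lparr>arcs := S\<rparr>)) (arcs (D\<lparr>arcs := S\<rparr>))"
      using inj_on_subset[OF inj_tail assms(2)] inj_on_subset[OF inj_head assms(2)] by simp_all
  qed (use assms(2) in auto)
qed

text \<open>
  Deleting arcs from a disjoint union of paths and cycles leaves such a union, so there is no
  condition on the arc set of a cover.
\<close>

lemma path_cycle_covers_eq_Pow:
  assumes "linear_digraph D"
  shows "path_cycle_covers D = Pow (arcs D)"
proof (rule set_eqI)
  show "S \<in> path_cycle_covers D \<longleftrightarrow> S \<in> Pow (arcs D)" for S
    using linear_digraph.partition_on_blocks[OF linear_digraph_subset_arcs[OF assms, of S]]
    by (cases "S \<subseteq> arcs D") (simp_all add: path_cycle_covers_def)
qed

lemma card_cover_paths:
  assumes "linear_digraph D" "S \<subseteq> arcs D"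
  shows "card (cover_paths D S) = card (verts D) - card S"
  using linear_digraph.card_path_blocks[OF linear_digraph_subset_arcs[OF assms]] by simp

section \<open>Specialization of the symmetric functions\<close>

text \<open>
  The exponents of a monomial, that is the parts of the partition \<open>lam\<close> for which the monomial
  occurs in \<open>monomial_sym lam\<close>.
\<close>

definition multiplicities :: "'a multiset \<Rightarrow> nat multiset" where
  "multiplicities A = image_mset (count A) (mset_set (set_mset A))"

definition monomials_of_type :: "'a set \<Rightarrow> nat multiset \<Rightarrow> 'a multiset set" where
  "monomials_of_type I L = {A. set_mset A \<subseteq> I \<and> multiplicities A = L}"

text \<open>
  The factor \<open>r\<^sub>1! r\<^sub>2! \<dots>\<close> of the augmented monomial symmetric function.
\<close>

definition symmetry :: "nat multiset \<Rightarrow> nat" where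
  "symmetry L = (\<Prod>r\<in>set_mset L. fact (count L r))"

text \<open>
  The degree of a monomial is the sum of its exponents. It bounds the degree of the series, which
  keeps the sums in the specialization finite.
\<close>

lemma sum_multiplicities: "sum_mset (multiplicities A) = size A"
  by (simp add: multiplicities_def size_multiset_overloaded_eq sum_unfold_sum_mset)

lemma finite_bounded_multisets:
  assumes "finite I"
  shows "finite {A. set_mset A \<subseteq> I \<and> size A \<le> n}"
proof (rule finite_subset)
  show "{A. set_mset A \<subseteq> I \<and> size A \<le> n} \<subseteq> mset ` {xs. set xs \<subseteq> I \<and> length xs \<le> n}"
  proof
    fix A assume "A \<in> {A. set_mset A \<subseteq> I \<and> size A \<le> n}"
    moreover obtain xs where "mset xs = A" using ex_mset by blast
    ultimately show "A \<in> mset ` {xs. set xs \<subseteq> I \<and> length xs \<le> n}"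
      by (auto intro!: image_eqI[of _ _ xs])
  qed
  show "finite (mset ` {xs. set xs \<subseteq> I \<and> length xs \<le> n})"
    by (intro finite_imageI finite_lists_length_le assms)
qed

lemma finite_monomials_of_type: "finite I \<Longrightarrow> finite (monomials_of_type I L)"
  by (rule finite_subset[OF _ finite_bounded_multisets[of I "sum_mset L"]])
    (auto simp: monomials_of_type_def simp flip: sum_multiplicities)

lemma multiplicities_add_replicate:
  assumes "k \<notin># A" "0 < r"
  shows "multiplicities (A + replicate_mset r k) = add_mset r (multiplicities A)"
proof -
  have "image_mset (count (A + replicate_mset r k)) (mset_set (set_mset A)) =
      image_mset (count A) (mset_set (set_mset A))"
    using assms by (intro image_mset_cong) (auto simp: count_replicate_mset)
  moreover have "count A k = 0" using assms by (simp add: not_in_iff)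
  ultimately show ?thesis
    using assms by (simp add: multiplicities_def)
qed

lemma symmetry_superset:
  assumes "finite S" "set_mset L \<subseteq> S"
  shows "symmetry L = (\<Prod>r\<in>S. fact (count L r))"
  unfolding symmetry_def
  by (rule prod.mono_neutral_left) (use assms in \<open>auto simp: not_in_iff\<close>)

lemma symmetry_remove:
  assumes "r \<in># L"
  shows "symmetry L = count L r * symmetry (L - {#r#})"
proof -
  obtain L' where L: "L = add_mset r L'" using assms by (blast dest: multi_member_split)
  let ?S = "insert r (set_mset L')"
  have "symmetry L = fact (Suc (count L' r)) * (\<Prod>s\<in>?S - {r}. fact (count L s))"
    by (subst symmetry_superset[of ?S]) (auto simp: L prod.remove[of ?S r])
  moreover have "symmetry L' = fact (count L' r) * (\<Prod>s\<in>?S - {r}. fact (count L' s))"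
    by (subst symmetry_superset[of ?S]) (auto simp: prod.remove[of ?S r])
  moreover have "(\<Prod>s\<in>?S - {r}. fact (count L s)) = ((\<Prod>s\<in>?S - {r}. fact (count L' s)) :: nat)"
    by (rule prod.cong) (auto simp: L)
  ultimately show ?thesis by (simp add: L algebra_simps)
qed

text \<open>
  A new indeterminate either does not occur in the monomial or occurs with an exponent that is one
  of the parts. Zero parts are excluded, because an indeterminate with exponent zero does not occur.
\<close>

lemma card_monomials_of_type_insert:
  assumes "finite I" "k \<notin> I" "0 \<notin># L"
  shows "card (monomials_of_type (insert k I) L) =
    card (monomials_of_type I L) + (\<Sum>r\<in>set_mset L. card (monomials_of_type I (L - {#r#})))"
proof -
  let ?M = "\<lambda>r. (\<lambda>A. A + replicate_mset r k) ` monomials_of_type I (L - {#r#})"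
  have k: "k \<notin># A" if "A \<in> monomials_of_type I L'" for A L'
    using that assms(2) by (auto simp: monomials_of_type_def)
  have count: "count A k = r" if "A \<in> ?M r" for A r
    using that k by (auto simp: not_in_iff)
  have pos: "0 < r" if "r \<in># L" for r using that assms(3) by (cases r) auto
  have split: "monomials_of_type (insert k I) L =
    monomials_of_type I L \<union> (\<Union>r\<in>set_mset L. ?M r)"
  proof (intro equalityI subsetI)
    fix A assume A: "A \<in> monomials_of_type (insert k I) L"
    show "A \<in> monomials_of_type I L \<union> (\<Union>r\<in>set_mset L. ?M r)"
    proof (cases "k \<in># A")
      case False
      then show ?thesis using A by (auto simp: monomials_of_type_def)
    next
      case True
      define A' where "A' = filter_mset (\<lambda>x. x \<noteq> k) A"
      let ?r = "count A k"
      have split: "A = A' + replicate_mset ?r k"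
        unfolding A'_def by (rule multiset_eqI) (auto simp: count_replicate_mset)
      have "multiplicities A = add_mset ?r (multiplicities A')"
        by (subst (1) split, rule multiplicities_add_replicate) (use True in \<open>auto simp: A'_def\<close>)
      then have L: "L = add_mset ?r (multiplicities A')"
        using A by (simp add: monomials_of_type_def)
      then have "?r \<in># L" by (metis union_single_eq_member)
      have "multiplicities A' = L - {#?r#}" by (subst L) simp
      moreover have "set_mset A' \<subseteq> I"
        using A by (auto simp: A'_def monomials_of_type_def)
      ultimately have "A \<in> ?M ?r"
        using split by (auto simp: monomials_of_type_def)
      then show ?thesis using \<open>?r \<in># L\<close> by blast
    qed
  next
    fix A assume "A \<in> monomials_of_type I L \<union> (\<Union>r\<in>set_mset L. ?M r)"
    then show "A \<in> monomials_of_type (insert k I) L"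
    proof
      assume "A \<in> monomials_of_type I L"
      then show ?thesis by (auto simp: monomials_of_type_def)
    next
      assume "A \<in> (\<Union>r\<in>set_mset L. ?M r)"
      then obtain r A' where A': "r \<in># L" "A' \<in> monomials_of_type I (L - {#r#})"
        "A = A' + replicate_mset r k" by blast
      then have "multiplicities A = L"
        using multiplicities_add_replicate[OF k[OF A'(2)] pos[OF A'(1)]]
        by (simp add: monomials_of_type_def)
      then show ?thesis using A' by (auto simp: monomials_of_type_def split: if_splits)
    qed
  qed
  have fin: "finite (\<Union>r\<in>set_mset L. ?M r)"
    using assms(1) by (auto intro: finite_monomials_of_type)
  have "card (\<Union>r\<in>set_mset L. ?M r) = (\<Sum>r\<in>set_mset L. card (?M r))"
  proof (rule card_UN_disjoint)
    show "\<forall>r\<in>set_mset L. \<forall>s\<in>set_mset L. r \<noteq> s \<longrightarrow> ?M r \<inter> ?M s = {}"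
      using count by (metis disjoint_iff)
  qed (use assms(1) in \<open>auto intro: finite_monomials_of_type\<close>)
  also have "\<dots> = (\<Sum>r\<in>set_mset L. card (monomials_of_type I (L - {#r#})))"
    by (intro sum.cong refl card_image) (auto simp: inj_on_def)
  finally have "card (\<Union>r\<in>set_mset L. ?M r) = (\<Sum>r\<in>set_mset L. card (monomials_of_type I (L - {#r#})))" .
  moreover have "monomials_of_type I L \<inter> (\<Union>r\<in>set_mset L. ?M r) = {}"
  proof (intro equalityI subsetI)
    fix A assume A: "A \<in> monomials_of_type I L \<inter> (\<Union>r\<in>set_mset L. ?M r)"
    then obtain r where "r \<in># L" "A \<in> ?M r" by blast
    then have "0 < count A k" using count pos by simp
    then show "A \<in> {}" using A k by auto
  qed simp
  ultimately show ?thesis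
    unfolding split using assms(1) fin by (simp add: card_Un_disjoint finite_monomials_of_type)
qed

text \<open>
  Both sides count the injective assignments of indeterminates from \<open>I\<close> to the parts. The proof is
  by induction on \<open>I\<close>: multiplied by \<open>symmetry L\<close>, the recursion for the number of monomials becomes
  Pascal's rule, because \<open>symmetry L = count L r * symmetry (L - {#r#})\<close> and the counts add up to the
  number of parts.
\<close>

lemma symmetry_card_monomials_of_type:
  fixes I :: "'a set"
  assumes "finite I" "0 \<notin># L"
  shows "symmetry L * card (monomials_of_type I L) = fact (size L) * (card I choose size L)"
  using assms
proof (induction I arbitrary: L rule: finite_induct)
  case empty
  have "monomials_of_type ({} :: 'a set) L = (if L = {#} then {{#}} else {})"
    by (auto simp: monomials_of_type_def multiplicities_def)
  then show ?case by (cases "size L") (auto simp: symmetry_def)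
next
  case (insert k I)
  show ?case
  proof (cases "L = {#}")
    case True
    then show ?thesis
      using insert.IH[of L] insert.hyps by (simp add: card_monomials_of_type_insert)
  next
    case False
    then obtain m where m: "size L = Suc m" by (cases "size L") auto
    have "symmetry L * (\<Sum>r\<in>set_mset L. card (monomials_of_type I (L - {#r#}))) =
        (\<Sum>r\<in>set_mset L. count L r * (fact m * (card I choose m)))"
      unfolding sum_distrib_left
    proof (rule sum.cong)
      fix r assume r: "r \<in> set_mset L"
      have "0 \<notin># L - {#r#}" using insert.prems by (auto dest: in_diffD)
      then have "symmetry (L - {#r#}) * card (monomials_of_type I (L - {#r#})) =
          fact m * (card I choose m)"
        using insert.IH[of "L - {#r#}"] r m by (simp add: size_Diff_singleton)
      then show "symmetry L * card (monomials_of_type I (L - {#r#})) =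
          count L r * (fact m * (card I choose m))"
        by (simp add: symmetry_remove[OF r] mult.assoc)
    qed simp
    also have "\<dots> = Suc m * (fact m * (card I choose m))"
      using m by (simp add: size_multiset_overloaded_eq flip: sum_distrib_right)
    finally show ?thesis
      using insert.IH[OF insert.prems] insert.hyps insert.prems m
      by (simp add: card_monomials_of_type_insert algebra_simps)
  qed
qed

lemma aug_monomial_sym_eq:
  "aug_monomial_sym lam A = of_nat (symmetry (mset lam)) * of_bool (multiplicities A = mset lam)"
  by (simp add: aug_monomial_sym_def monomial_sym_def symmetry_def multiplicities_def
      count_mset flip: count_mset)

lemma aug_monomial_sym_eq_0: "size A \<noteq> sum_list lam \<Longrightarrow> aug_monomial_sym lam A = 0"
  using sum_multiplicities[of A] by (auto simp: aug_monomial_sym_eq sum_mset_sum_list)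

text \<open>
  The specialization of \<open>aug_monomial_sym lam\<close> at \<open>card I\<close> ones. The degree bound \<open>N\<close> makes the
  set of monomials finite and can be shared by several partitions.
\<close>

lemma sum_aug_monomial_sym:
  assumes "finite I" "\<forall>k\<in>set lam. 0 < k" "sum_list lam \<le> N"
  shows "(\<Sum>A | set_mset A \<subseteq> I \<and> size A \<le> N. aug_monomial_sym lam A) =
    fact (length lam) * of_nat (card I choose length lam)"
proof -
  have eq: "{A. set_mset A \<subseteq> I \<and> size A \<le> N} \<inter> {A. multiplicities A = mset lam} =
      monomials_of_type I (mset lam)"
    using assms(3)
    by (auto simp: monomials_of_type_def sum_mset_sum_list simp flip: sum_multiplicities)
  have "(\<Sum>A | set_mset A \<subseteq> I \<and> size A \<le> N. aug_monomial_sym lam A) =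
      of_nat (symmetry (mset lam)) * of_nat (card (monomials_of_type I (mset lam)))"
    unfolding aug_monomial_sym_eq sum_distrib_left[symmetric]
    using finite_bounded_multisets[OF assms(1), of N] by (simp add: sum_of_bool_eq eq)
  also have "\<dots> = of_nat (fact (length lam) * (card I choose length lam))"
    using symmetry_card_monomials_of_type[OF assms(1), of "mset lam"] assms(2)
    by (auto simp flip: of_nat_mult)
  finally show ?thesis by simp
qed

lemma multiset_over_singleton: "set_mset B \<subseteq> {j} \<Longrightarrow> B = replicate_mset (size B) j"
  by (metis set_mset_subset_singletonD)

lemma submultisets_replicate:
  "{A. A \<subseteq># replicate_mset n j} = (\<lambda>a. replicate_mset a j) ` {..n}"
proof (intro equalityI subsetI)
  fix A assume "A \<in> {A. A \<subseteq># replicate_mset n j}"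
  then have "A \<subseteq># replicate_mset n j" by simp
  then have "set_mset A \<subseteq> {j}" "size A \<le> n"
    using set_mset_mono[of A] size_mset_mono[of A] by (force split: if_splits)+
  then show "A \<in> (\<lambda>a. replicate_mset a j) ` {..n}"
    by (intro image_eqI[of _ _ "size A"] multiset_over_singleton) simp_all
qed (auto simp: subseteq_mset_def)

text \<open>
  With a single indeterminate, a power sum product is that indeterminate to the power of the degree.
\<close>

lemma power_sum_replicate: "power_sum mu (replicate_mset n j) = of_bool (n = sum_list mu)"
proof (induction mu arbitrary: n)
  case Nil
  show ?case by (simp add: power_sum_def series_one_def)
next
  case (Cons r mu)
  have inj: "inj_on (\<lambda>a. replicate_mset a j) S" for S
    by (rule inj_onI) (metis size_replicate_mset)
  have p1: "power_sum1 r (replicate_mset a j) = of_bool (a = r)" for a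
    by (auto simp: power_sum1_def dest: arg_cong[of _ _ size])
  have minus: "replicate_mset n j - replicate_mset a j = replicate_mset (n - a) j" for a
    by (rule multiset_eqI) (simp add: count_replicate_mset)
  have "power_sum (r # mu) (replicate_mset n j) =
      series_times (power_sum1 r) (power_sum mu) (replicate_mset n j)"
    by (simp add: power_sum_def)
  also have "\<dots> = (\<Sum>a\<le>n. of_bool (a = r) * of_bool (n - a = sum_list mu))"
    unfolding series_times_def submultisets_replicate
    by (simp add: sum.reindex[OF inj] p1 minus Cons.IH)
  also have "\<dots> = (\<Sum>a\<in>{..n} \<inter> {r}. of_bool (n - r = sum_list mu))"
    by (rule sum.mono_neutral_cong_right) auto
  also have "\<dots> = of_bool (n = sum_list (r # mu))"
    by (cases "r \<le> n") auto
  finally show ?case .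
qed

lemma power_sum_singleton:
  "set_mset B \<subseteq> {j} \<Longrightarrow> power_sum mu B = of_bool (size B = sum_list mu)"
  by (metis multiset_over_singleton power_sum_replicate)

lemma sum_power_sum:
  assumes "sum_list mu \<le> N"
  shows "(\<Sum>B | set_mset B \<subseteq> {j} \<and> size B \<le> N. power_sum mu B) = 1"
proof -
  have "(\<Sum>B | set_mset B \<subseteq> {j} \<and> size B \<le> N. power_sum mu B) =
      (\<Sum>B\<in>{replicate_mset (sum_list mu) j}. 1)"
  proof (rule sum.mono_neutral_cong_right)
    show "\<forall>B\<in>{B. set_mset B \<subseteq> {j} \<and> size B \<le> N} - {replicate_mset (sum_list mu) j}.
        power_sum mu B = 0"
    proof
      fix B assume B: "B \<in> {B. set_mset B \<subseteq> {j} \<and> size B \<le> N} - {replicate_mset (sum_list mu) j}"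
      then have sub: "set_mset B \<subseteq> {j}" by simp
      with B have "size B \<noteq> sum_list mu" using multiset_over_singleton[OF sub] by auto
      then show "power_sum mu B = 0" by (simp add: power_sum_singleton[OF sub])
    qed
  qed (use assms in \<open>auto simp: finite_bounded_multisets power_sum_replicate\<close>)
  then show ?thesis by simp
qed

lemma prod_mset_of_bool: "(\<Prod>k\<in>#A. of_bool (P k)) = (of_bool (\<forall>k\<in>#A. P k) :: rat)"
  by (induction A) auto

text \<open>
  The falling factorial from the augmented monomial function is divided by the factorial of the
  number of parts, which leaves a binomial coefficient. The power sums contribute a factor 1.
\<close>

lemma subst2_sum_aug_monomial_power_sum:
  assumes I: "finite I" and fin: "finite C"
    and pos: "\<And>S. S \<in> C \<Longrightarrow> \<forall>k\<in>set (a S). 0 < k"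
    and g: "\<And>A B. g A B = (\<Sum>S\<in>C. aug_monomial_sym (a S) A * power_sum (b S) B /
      fact (length (a S)))"
  shows "subst2 g (\<lambda>k. of_bool (k \<in> I)) (\<lambda>k. of_bool (k = j)) =
    (\<Sum>S\<in>C. of_nat (card I choose length (a S)))"
proof -
  \<comment> \<open>one degree bound for all the summands, so that the finite sums can be exchanged\<close>
  define N where "N = (\<Sum>S\<in>C. sum_list (a S) + sum_list (b S))"
  have N: "sum_list (a S) \<le> N" "sum_list (b S) \<le> N" if "S \<in> C" for S
    using member_le_sum[OF that, of "\<lambda>S. sum_list (a S) + sum_list (b S)"] fin
    by (auto simp: N_def)
  let ?X = "{A. set_mset A \<subseteq> I \<and> size A \<le> N}" and ?Y = "{B. set_mset B \<subseteq> {j} \<and> size B \<le> N}"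
  let ?h = "\<lambda>(A, B). g A B * (\<Prod>k\<in>#A. of_bool (k \<in> I)) * (\<Prod>k\<in>#B. of_bool (k = j))"
  have h: "?h (A, B) = g A B * of_bool (set_mset A \<subseteq> I) * of_bool (set_mset B \<subseteq> {j})" for A B
    by (auto simp: prod_mset_of_bool subset_iff)
  have supp: "{AB. ?h AB \<noteq> 0} \<subseteq> ?X \<times> ?Y"
  proof
    fix AB assume AB0: "AB \<in> {AB. ?h AB \<noteq> 0}"
    obtain A B where AB_eq: "AB = (A, B)" by (cases AB)
    with AB0 have "?h (A, B) \<noteq> 0" by simp
    then have AB: "g A B \<noteq> 0" "set_mset A \<subseteq> I" "set_mset B \<subseteq> {j}"
      unfolding h by (auto split: if_splits)
    from AB(1) obtain S where S: "S \<in> C" and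
      "aug_monomial_sym (a S) A * power_sum (b S) B / fact (length (a S)) \<noteq> 0"
      unfolding g by (rule sum.not_neutral_contains_not_neutral)
    then have "aug_monomial_sym (a S) A \<noteq> 0" "power_sum (b S) B \<noteq> 0" by auto
    then have "size A = sum_list (a S)" "size B = sum_list (b S)"
      using aug_monomial_sym_eq_0 power_sum_singleton[OF AB(3)] by (auto split: if_splits)
    then show "AB \<in> ?X \<times> ?Y" using AB AB_eq N[OF S] by simp
  qed
  have "subst2 g (\<lambda>k. of_bool (k \<in> I)) (\<lambda>k. of_bool (k = j)) = sum ?h (?X \<times> ?Y)"
    unfolding subst2_def
    by (rule Sum_any.expand_superset[OF _ supp])
      (use I in \<open>simp add: finite_bounded_multisets\<close>)
  also have "\<dots> = (\<Sum>(A, B)\<in>?X \<times> ?Y. g A B)"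
    by (rule sum.cong) (auto simp: prod_mset_of_bool subset_iff)
  also have "\<dots> = (\<Sum>S\<in>C. \<Sum>(A, B)\<in>?X \<times> ?Y. aug_monomial_sym (a S) A * power_sum (b S) B /
      fact (length (a S)))"
    unfolding g by (subst sum.swap) (simp add: case_prod_unfold)
  also have "\<dots> = (\<Sum>S\<in>C. (\<Sum>A\<in>?X. aug_monomial_sym (a S) A) * (\<Sum>B\<in>?Y. power_sum (b S) B) /
      fact (length (a S)))"
    by (simp add: sum_product sum.cartesian_product sum_divide_distrib case_prod_unfold)
  also have "\<dots> = (\<Sum>S\<in>C. of_nat (card I choose length (a S)))"
    by (intro sum.cong refl)
      (use I N pos in \<open>simp add: sum_aug_monomial_sym sum_power_sum\<close>)
  finally show ?thesis .
qed

section \<open>Digraphs of disjoint paths and cycles\<close>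

lemma Suc_mod_inj: "k < m \<Longrightarrow> l < m \<Longrightarrow> Suc k mod m = Suc l mod m \<Longrightarrow> k = (l::nat)"
  by (auto simp: mod_Suc split: if_splits)

lemma finite_verts_path_cycle_digraph: "finite (verts (path_cycle_digraph lam mu))"
  and card_verts_path_cycle_digraph:
    "card (verts (path_cycle_digraph lam mu)) = sum_list lam + sum_list mu"
proof -
  let ?V = "\<lambda>xs. SIGMA i:{..<length xs}. {..<xs ! i}"
  have V: "verts (path_cycle_digraph lam mu) = Inl ` ?V lam \<union> Inr ` ?V mu"
    by (auto simp: path_cycle_digraph_def)
  have "card (?V xs) = sum_list xs" for xs
    by (simp add: sum_list_sum_nth atLeast0LessThan)
  then have "card (Inl ` ?V lam :: pc_vertex set) = sum_list lam"
    "card (Inr ` ?V mu :: pc_vertex set) = sum_list mu"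
    by (simp_all add: card_image)
  then show "card (verts (path_cycle_digraph lam mu)) = sum_list lam + sum_list mu"
    unfolding V by (subst card_Un_disjoint) auto
  show "finite (verts (path_cycle_digraph lam mu))"
    unfolding V by simp
qed

lemma path_cycle_digraph_arc_cases:
  assumes "e \<in> arcs (path_cycle_digraph lam mu)"
  obtains i k where "e = (Inl (i, k), Inl (i, Suc k))" "i < length lam" "Suc k < lam ! i"
  | j k where "e = (Inr (j, k), Inr (j, Suc k mod mu ! j))" "j < length mu" "k < mu ! j"
  using assms by (auto simp: path_cycle_digraph_def)

lemma linear_digraph_path_cycle_digraph: "linear_digraph (path_cycle_digraph lam mu)"
proof -
  let ?D = "path_cycle_digraph lam mu"
  have ends: "tail ?D = fst" "head ?D = snd" by (simp_all add: path_cycle_digraph_def)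
  show ?thesis
  proof
    fix e assume e: "e \<in> arcs ?D"
    show "tail ?D e \<in> verts ?D" "head ?D e \<in> verts ?D"
      using e by (cases rule: path_cycle_digraph_arc_cases; force simp: path_cycle_digraph_def)+
  next
    show "finite (verts ?D)" by (rule finite_verts_path_cycle_digraph)
    have "arcs ?D \<subseteq> verts ?D \<times> verts ?D"
    proof
      fix e assume "e \<in> arcs ?D"
      then show "e \<in> verts ?D \<times> verts ?D"
        by (cases rule: path_cycle_digraph_arc_cases) (auto simp: path_cycle_digraph_def)
    qed
    then show "finite (arcs ?D)"
      by (rule finite_subset) (intro finite_cartesian_product finite_verts_path_cycle_digraph)
    show "inj_on (tail ?D) (arcs ?D)"
      unfolding ends
    proof (rule inj_onI)
      fix e f assume e: "e \<in> arcs ?D" and f: "f \<in> arcs ?D" and eq: "fst e = fst f"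
      from e show "e = f"
      proof (cases rule: path_cycle_digraph_arc_cases)
        case 1
        from f show ?thesis using 1 eq by (cases rule: path_cycle_digraph_arc_cases) simp_all
      next
        case (2 j k)
        from f show ?thesis using 2 eq by (cases rule: path_cycle_digraph_arc_cases) simp_all
      qed
    qed
    show "inj_on (head ?D) (arcs ?D)"
      unfolding ends
    proof (rule inj_onI)
      fix e f assume e: "e \<in> arcs ?D" and f: "f \<in> arcs ?D" and eq: "snd e = snd f"
      from e show "e = f"
      proof (cases rule: path_cycle_digraph_arc_cases)
        case 1
        from f show ?thesis using 1 eq by (cases rule: path_cycle_digraph_arc_cases) simp_all
      next
        case (2 j k)
        from f show ?thesis
        proof (cases rule: path_cycle_digraph_arc_cases)
          case 1
          then show ?thesis using 2 eq by simp
        next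
          case (2 j' k')
          then show ?thesis
            using \<open>e = _\<close> \<open>k < mu ! j\<close> eq Suc_mod_inj[of k "mu ! j" k'] by auto
        qed
      qed
    qed
  qed
qed

text \<open>
  Every vertex is the head of exactly one arc, except for the starting points of the paths.
\<close>

lemma card_arcs_path_cycle_digraph:
  assumes "\<forall>k\<in>set lam. 0 < k"
  shows "card (arcs (path_cycle_digraph lam mu)) + length lam = sum_list lam + sum_list mu"
proof -
  let ?D = "path_cycle_digraph lam mu" and ?I = "(\<lambda>i. Inl (i, 0)) ` {..<length lam} :: pc_vertex set"
  interpret D: linear_digraph ?D by (rule linear_digraph_path_cycle_digraph)
  have head: "head ?D = snd" by (simp add: path_cycle_digraph_def)
  have "head ?D ` arcs ?D = verts ?D - ?I"
  proof (intro equalityI subsetI)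
    fix x assume "x \<in> head ?D ` arcs ?D"
    then obtain e where e: "e \<in> arcs ?D" "x = snd e" unfolding head by blast
    then show "x \<in> verts ?D - ?I"
      using D.head_in_verts[OF e(1)] head
      by (cases rule: path_cycle_digraph_arc_cases) auto
  next
    fix x assume x: "x \<in> verts ?D - ?I"
    show "x \<in> head ?D ` arcs ?D"
    proof (cases x)
      case (Inl a)
      then obtain i k where a: "a = (i, Suc k)" "i < length lam" "Suc k < lam ! i"
        using x by (cases a; cases "snd a") (auto simp: path_cycle_digraph_def)
      then have "(Inl (i, k), Inl (i, Suc k)) \<in> arcs ?D" by (simp add: path_cycle_digraph_def)
      then show ?thesis unfolding head using Inl a(1) by force
    next
      case (Inr a)
      then obtain j k where a: "a = (j, k)" "j < length mu" "k < mu ! j"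
        using x by (cases a) (auto simp: path_cycle_digraph_def)
      \<comment> \<open>the predecessor on the cycle, where 0 is preceded by the last vertex\<close>
      define l where "l = (if k = 0 then mu ! j - 1 else k - 1)"
      have "l < mu ! j" "Suc l mod mu ! j = k" using a by (auto simp: l_def)
      then have "(Inr (j, l), Inr (j, k)) \<in> arcs ?D" using a by (auto simp: path_cycle_digraph_def)
      then show ?thesis unfolding head using Inr a(1) by force
    qed
  qed
  then have "card (arcs ?D) = card (verts ?D - ?I)"
    using card_image[OF D.inj_head] by simp
  moreover have "?I \<subseteq> verts ?D" using assms by (auto simp: path_cycle_digraph_def)
  moreover have "card ?I = length lam" by (simp add: card_image inj_on_def)
  ultimately show ?thesis
    using card_verts_path_cycle_digraph[of lam mu] card_mono[OF D.finite_verts, of ?I]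
    by (simp add: card_Diff_subset)
qed

section \<open>Summation over the covers\<close>

lemma length_block_sizes: "length (block_sizes P) = card P"
  by (simp add: block_sizes_def flip: size_mset)

lemma set_block_sizes: "finite P \<Longrightarrow> set (block_sizes P) = card ` P"
  by (simp add: block_sizes_def)

lemma cover_paths_positive:
  assumes "linear_digraph D" "S \<subseteq> arcs D"
  shows "\<forall>k\<in>set (block_sizes (cover_paths D S)). 0 < k"
proof -
  let ?H = "D\<lparr>arcs := S\<rparr>"
  interpret H: linear_digraph ?H by (rule linear_digraph_subset_arcs[OF assms])
  note part = H.partition_on_blocks
  have "finite (cover_paths D S)"
    using finite_elements[OF H.finite_verts part] by simp
  moreover have "0 < card B" if "B \<in> cover_paths D S" for B
  proof -
    have "B \<noteq> {}" "B \<subseteq> verts ?H"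
      using that partition_onD1[OF part] partition_onD3[OF part] by blast+
    then show ?thesis by (metis H.finite_verts card_gt_0_iff finite_subset)
  qed
  ultimately show ?thesis by (simp add: set_block_sizes)
qed

lemma sum_Pow_card:
  fixes f :: "nat \<Rightarrow> nat"
  assumes "finite E" "card E \<le> d"
  shows "(\<Sum>S\<in>Pow E. f (card S)) = (\<Sum>k\<le>d. (card E choose k) * f k)"
proof -
  have "(\<Sum>S\<in>Pow E. f (card S)) = (\<Sum>k\<le>d. \<Sum>S | S \<in> Pow E \<and> card S = k. f (card S))"
    by (rule sum.group[symmetric])
      (use assms in \<open>auto intro: order_trans[OF card_mono]\<close>)
  also have "\<dots> = (\<Sum>k\<le>d. (card E choose k) * f k)"
    by (intro sum.cong refl) (use assms in \<open>simp add: n_subsets Pow_def\<close>)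
  finally show ?thesis .
qed

lemma gbinomial_poly:
  fixes c :: "'a::field_char_0"
  shows "\<exists>P. \<forall>x. poly P x = (x + c) gchoose d"
proof -
  let ?P = "smult (1 / fact d) (\<Prod>i = 0..<d. [:c - of_nat i, 1:])"
  have "poly ?P x = (x + c) gchoose d" for x
    by (simp add: poly_prod gbinomial_prod_rev algebra_simps)
  then show ?thesis by blast
qed

theorem proposition15:
  fixes lam mu :: "nat list" and d :: nat
  assumes "integer_partition lam" and "integer_partition mu"
    and "d = sum_list lam + sum_list mu"
  shows "\<exists>P. is_ones_poly (Xi_tilde lam mu) P \<and>
           (\<forall>i. poly P i = (i + of_nat d - of_nat (length lam)) gchoose d)"
proof -
  let ?D = "path_cycle_digraph lam mu"
  let ?E = "arcs ?D"
  interpret D: linear_digraph ?D by (rule linear_digraph_path_cycle_digraph)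
  have E: "card ?E + length lam = d"
    using card_arcs_path_cycle_digraph[of lam mu] assms(1,3) by (simp add: integer_partition_def)
  have covers: "path_cycle_covers ?D = Pow ?E"
    by (rule path_cycle_covers_eq_Pow) (rule linear_digraph_path_cycle_digraph)
  have paths: "card (cover_paths ?D S) = d - card S" if "S \<in> Pow ?E" for S
    using card_cover_paths[OF linear_digraph_path_cycle_digraph, of S lam mu] that assms(3)
    by (simp add: card_verts_path_cycle_digraph)
  obtain P where P: "\<And>x :: rat. poly P x = (x + (of_nat d - of_nat (length lam))) gchoose d"
    using gbinomial_poly by blast
  have "subst2 (Xi_tilde lam mu) (\<lambda>k. of_bool (k \<in> I)) (\<lambda>k. of_bool (k = j)) =
      poly P (of_nat (card I))" if "finite I" for I j
  proof -
    have "subst2 (Xi_tilde lam mu) (\<lambda>k. of_bool (k \<in> I)) (\<lambda>k. of_bool (k = j)) =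
        (\<Sum>S\<in>Pow ?E. of_nat (card I choose length (block_sizes (cover_paths ?D S))))"
    proof (rule subst2_sum_aug_monomial_power_sum[OF that])
      show "\<forall>k\<in>set (block_sizes (cover_paths ?D S)). 0 < k" if "S \<in> Pow ?E" for S
        using cover_paths_positive[OF linear_digraph_path_cycle_digraph] that by blast
      show "Xi_tilde lam mu A B = (\<Sum>S\<in>Pow ?E.
          aug_monomial_sym (block_sizes (cover_paths ?D S)) A *
          power_sum (block_sizes (cover_cycles ?D S)) B /
          fact (length (block_sizes (cover_paths ?D S))))" for A B
        by (simp add: Xi_tilde_def Let_def covers length_block_sizes)
    qed simp
    also have "\<dots> = of_nat (\<Sum>S\<in>Pow ?E. card I choose (d - card S))"
      by (simp add: length_block_sizes paths)
    \<comment> \<open>group the covers by their number of arcs and apply Vandermonde's identity\<close>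
    also have "(\<Sum>S\<in>Pow ?E. card I choose (d - card S)) = (card ?E + card I) choose d"
      using E by (simp add: sum_Pow_card[of ?E d "\<lambda>k. card I choose (d - k)"] vandermonde)
    also have "of_nat \<dots> = (of_nat (card I) + (of_nat d - of_nat (length lam)) :: rat) gchoose d"
      unfolding E[symmetric] by (simp add: binomial_gbinomial add.commute)
    finally show ?thesis by (simp add: P)
  qed
  then have "is_ones_poly (Xi_tilde lam mu) P" by (simp add: is_ones_poly_def)
  then show ?thesis using P by (auto simp: add_diff_eq)
qed

end
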